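(* Let $(\theta_n)$ and $(\alpha_n)$ be sequences of nonnegative reals such that $\sum_{i=0}^\infty\alpha_i$ diverges, and suppose that for any $\varepsilon>0$ there exist some $\delta>0$ and $N\in\mathbb{N}$ such that $$(\ast)\quad\forall n\geq N\ (\varepsilon<\theta_{n+1}\to\theta_{n+1}\leq\theta_n-\alpha_n\cdot\delta).$$ Then $\theta_n\to0$ as $n\to\infty$. Moreover, if: (i) $K\in(0,\infty)$ satisfies $\theta_n<K$ for all $n\in\mathbb{N}$, (ii) $r:\mathbb{N}\times(0,\infty)\to\mathbb{N}$ is a rate of divergence for $\sum_{i=0}^\infty\alpha_i$, (iii) $N:(0,\infty)\to\mathbb{N}$ and $\varphi:(0,\infty)\to(0,\infty)$ witness property $(\ast)$ in the sense that for all $\varepsilon>0$ we have $$\forall n\geq N(\varepsilon)\ (\varepsilon<\theta_{n+1}\to\theta_{n+1}\leq\theta_n-\alpha_n\cdot\varphi(\varepsilon)),$$ then $\Psi_{K,r,N,\varphi}(\varepsilon):=r(N(\varepsilon),K/\varphi(\varepsilon))+1$ is a rate of convergence for $(\theta_n)$.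
   Context: $\mathbb{N}=\{0,1,2,\ldots\}$. A rate of convergence for a sequence of nonnegative reals $a_n\to 0$ is a function $\phi:(0,\infty)\to\mathbb{N}$ with $\forall\varepsilon>0\ \forall n\geq\phi(\varepsilon)\ (a_n\leq\varepsilon)$. A rate of divergence for $\sum_{i=0}^\infty\alpha_i=\infty$ (with $\alpha_i\ge 0$) is a function $r:\mathbb{N}\times(0,\infty)\to\mathbb{N}$ with $\sum_{i=N}^{r(N,x)}\alpha_i\geq x$ for all $N\in\mathbb{N}$, $x>0$, where $\sum_{i=N}^m\alpha_i=0$ if $m<N$ (so $r(N,x)\geq N$). *)

theory Defs
  imports "HOL-Analysis.Analysis"
begin

text \<open>
  Functions with domain \<open>(0,\<infinity>)\<close> are represented by total functions on \<^typ>\<open>real\<close>;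
  only their values at positive arguments are ever constrained or used.
\<close>

text \<open>Only used for sequences of nonnegative reals.\<close>

definition rate_of_convergence :: "(real \<Rightarrow> nat) \<Rightarrow> (nat \<Rightarrow> real) \<Rightarrow> bool" where
  "rate_of_convergence \<phi> a \<longleftrightarrow> (\<forall>\<epsilon>>0. \<forall>n\<ge>\<phi> \<epsilon>. a n \<le> \<epsilon>)"

text \<open>The sum over \<^term>\<open>{M..m}\<close> is \<open>0\<close> if \<open>m < M\<close>, so \<open>x > 0\<close> forces \<open>r M x \<ge> M\<close>.\<close>

definition rate_of_divergence :: "(nat \<Rightarrow> real \<Rightarrow> nat) \<Rightarrow> (nat \<Rightarrow> real) \<Rightarrow> bool" where
  "rate_of_divergence r \<alpha> \<longleftrightarrow> (\<forall>M. \<forall>x>0. (\<Sum>i=M..r M x. \<alpha> i) \<ge> x)"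

definition Psi :: "real \<Rightarrow> (nat \<Rightarrow> real \<Rightarrow> nat) \<Rightarrow> (real \<Rightarrow> nat) \<Rightarrow> (real \<Rightarrow> real) \<Rightarrow> real \<Rightarrow> nat" where
  "Psi K r N \<phi> \<epsilon> = r (N \<epsilon>) (K / \<phi> \<epsilon>) + 1"

end

(* Above the level \<epsilon>, the sequence is nonincreasing and every step n \<ge> N lowers it by at least
   \<alpha> n * \<delta>; since \<theta> stays nonnegative, it must drop to \<epsilon> before \<delta> times the accumulated
   \<alpha>-sum exceeds the initial value, and it can never climb above \<epsilon> again. *)
theory Submission
  imports Defs
begin

text \<open>Lying above \<open>\<epsilon>\<close> propagates backwards: a permitted step cannot
  increase \<open>\<theta>\<close>, so \<open>\<epsilon> < \<theta> (Suc k)\<close> at the last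
  index alone activates every descent step from \<open>M\<close> to \<open>k\<close>, and these add
  up.\<close>

lemma descent_telescope:
  fixes \<theta> \<alpha> :: "nat \<Rightarrow> real"
  assumes nonneg: "\<And>n. \<alpha> n \<ge> 0" and "\<delta> \<ge> 0"
    and step: "\<And>n. n \<ge> M \<Longrightarrow> \<epsilon> < \<theta> (Suc n) \<Longrightarrow> \<theta> (Suc n) \<le> \<theta> n - \<alpha> n * \<delta>"
    and "k \<ge> M" "\<epsilon> < \<theta> (Suc k)"
  shows "\<theta> (Suc k) \<le> \<theta> M - (\<Sum>i=M..k. \<alpha> i) * \<delta>"
  using \<open>k \<ge> M\<close> \<open>\<epsilon> < \<theta> (Suc k)\<close>
proof (induction k rule: dec_induct)
  case base
  then show ?case using step[of M] by simp
next
  case (step k)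
  have drop: "\<theta> (Suc (Suc k)) \<le> \<theta> (Suc k) - \<alpha> (Suc k) * \<delta>"
    using assms(3)[of "Suc k"] step by simp
  moreover have "\<alpha> (Suc k) * \<delta> \<ge> 0"
    using nonneg \<open>\<delta> \<ge> 0\<close> by simp
  ultimately have "\<theta> (Suc k) \<le> \<theta> M - (\<Sum>i=M..k. \<alpha> i) * \<delta>"
    using step by linarith
  with drop show ?case
    using step.hyps by (simp add: distrib_right)
qed

text \<open>Quantitative core of both claims. If \<open>\<theta> (Suc m)\<close> were above
  \<open>\<epsilon>\<close>, telescoping would give \<open>\<theta> (Suc m) < K - K = 0\<close>. The
  bound \<open>K\<close> concerns index \<open>M\<close> only, so it may be chosen after
  \<open>M\<close>.\<close>

lemma descent_below:
  fixes \<theta> \<alpha> :: "nat \<Rightarrow> real"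
  assumes theta: "\<And>n. \<theta> n \<ge> 0" and alpha: "\<And>n. \<alpha> n \<ge> 0"
    and "\<delta> > 0" "K > 0" "\<theta> M < K"
    and step: "\<And>n. n \<ge> M \<Longrightarrow> \<epsilon> < \<theta> (Suc n) \<Longrightarrow> \<theta> (Suc n) \<le> \<theta> n - \<alpha> n * \<delta>"
    and sum: "(\<Sum>i=M..m. \<alpha> i) \<ge> K / \<delta>"
    and "n \<ge> Suc m"
  shows "\<theta> n \<le> \<epsilon>"
proof -
  have K: "K \<le> (\<Sum>i=M..m. \<alpha> i) * \<delta>"
    using sum \<open>\<delta> > 0\<close> by (simp add: pos_divide_le_eq)
  \<comment> \<open>For \<open>m < M\<close> the sum would be empty, hence 0, against
    \<open>K > 0\<close>.\<close>
  have "m \<ge> M"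
  proof (rule ccontr)
    assume "\<not> m \<ge> M"
    with K \<open>K > 0\<close> show False by simp
  qed
  show ?thesis
    using \<open>n \<ge> Suc m\<close>
  proof (induction n rule: dec_induct)
    case base
    show ?case
    proof (rule ccontr)
      assume "\<not> \<theta> (Suc m) \<le> \<epsilon>"
      then have "\<theta> (Suc m) \<le> \<theta> M - (\<Sum>i=M..m. \<alpha> i) * \<delta>"
        using assms(3) \<open>m \<ge> M\<close> step
        by (intro descent_telescope[where \<alpha> = \<alpha> and \<epsilon> = \<epsilon>] alpha) auto
      then show False
        using K \<open>\<theta> M < K\<close> theta[of "Suc m"] by linarith
    qed
  next
    case (step n)
    \<comment> \<open>A value above \<open>\<epsilon>\<close> at \<open>Suc n\<close> would be at
      most \<open>\<theta> n\<close>, which is already at most \<open>\<epsilon>\<close>.\<close>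
    have "\<alpha> n * \<delta> \<ge> 0"
      using alpha \<open>\<delta> > 0\<close> by simp
    moreover have "n \<ge> M"
      using step.hyps \<open>m \<ge> M\<close> by simp
    ultimately show ?case
      using assms(6)[of n] step.IH by linarith
  qed
qed

text \<open>Bounded partial sums of nonnegative terms would make the shifted series summable, and a
  shift does not affect summability.\<close>

lemma nonsummable_tail_sum_ge:
  fixes \<alpha> :: "nat \<Rightarrow> real"
  assumes "\<And>n. \<alpha> n \<ge> 0" "\<not> summable \<alpha>"
  obtains m where "(\<Sum>i=M..m. \<alpha> i) \<ge> x"
proof -
  have "\<exists>n. (\<Sum>i<n. \<alpha> (i + M)) > x"
  proof (rule ccontr)
    assume "\<not> ?thesis"
    then have "summable (\<lambda>i. \<alpha> (i + M))"
      using assms(1) by (intro summableI_nonneg_bounded[where x = x]) (auto simp: not_less)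
    with assms(2) show False by (simp add: summable_iff_shift)
  qed
  then obtain n where n: "(\<Sum>i<n. \<alpha> (i + M)) > x" ..
  have "(\<Sum>i<n. \<alpha> (i + M)) = (\<Sum>i=M..<n + M. \<alpha> i)"
    using sum.shift_bounds_nat_ivl[of \<alpha> 0 M n] by (simp add: atLeast0LessThan)
  also have "\<dots> \<le> (\<Sum>i=M..n + M. \<alpha> i)"
    by (rule sum_mono2) (use assms(1) in auto)
  finally show thesis
    using n by (intro that[of "n + M"]) linarith
qed

theorem lemma3p4:
  fixes \<theta> \<alpha> :: "nat \<Rightarrow> real"
  assumes "\<And>n. \<theta> n \<ge> 0"
    and "\<And>n. \<alpha> n \<ge> 0"
    and "\<not> summable \<alpha>"
    and "\<forall>\<epsilon>>0. \<exists>\<delta>>0. \<exists>N. \<forall>n\<ge>N. \<epsilon> < \<theta> (n + 1) \<longrightarrow> \<theta> (n + 1) \<le> \<theta> n - \<alpha> n * \<delta>"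
  shows "\<theta> \<longlonglongrightarrow> 0 \<and>
    (\<forall>(K::real) (r :: nat \<Rightarrow> real \<Rightarrow> nat) (N :: real \<Rightarrow> nat) (\<phi> :: real \<Rightarrow> real).
      K > 0 \<and> (\<forall>n. \<theta> n < K) \<longrightarrow>
      rate_of_divergence r \<alpha> \<longrightarrow>
      (\<forall>\<epsilon>>0. \<phi> \<epsilon> > 0) \<longrightarrow>
      (\<forall>\<epsilon>>0. \<forall>n\<ge>N \<epsilon>. \<epsilon> < \<theta> (n + 1) \<longrightarrow> \<theta> (n + 1) \<le> \<theta> n - \<alpha> n * \<phi> \<epsilon>) \<longrightarrow>
      rate_of_convergence (Psi K r N \<phi>) \<theta>)"
proof (intro conjI allI impI)
  show "\<theta> \<longlonglongrightarrow> 0"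
  proof (rule LIMSEQ_I)
    fix e :: real
    assume "e > 0"
    then obtain \<delta> M where "\<delta> > 0"
      and step: "\<forall>n\<ge>M. e / 2 < \<theta> (n + 1) \<longrightarrow> \<theta> (n + 1) \<le> \<theta> n - \<alpha> n * \<delta>"
      \<comment> \<open>Halving \<open>e\<close> turns the non-strict bound of
        \<open>descent_below\<close> into the strict one required by the limit.\<close>
      using assms(4)[rule_format, of "e / 2"] by auto
    \<comment> \<open>\<open>\<theta> M + 1\<close> takes the role of \<open>K\<close>: it is
      positive and strictly above \<open>\<theta> M\<close>.\<close>
    obtain m where m: "(\<Sum>i=M..m. \<alpha> i) \<ge> (\<theta> M + 1) / \<delta>"
      by (rule nonsummable_tail_sum_ge[OF assms(2,3)])
    have "\<theta> n \<le> e / 2" if "n \<ge> Suc m" for n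
      by (rule descent_below[OF assms(1,2) \<open>\<delta> > 0\<close> _ _ _ m that])
        (use assms(1)[of M] \<open>e > 0\<close> step in auto)
    then have "norm (\<theta> n - 0) < e" if "n \<ge> Suc m" for n
      using assms(1)[of n] \<open>e > 0\<close> that by force
    then show "\<exists>no. \<forall>n\<ge>no. norm (\<theta> n - 0) < e"
      by blast
  qed
next
  fix K :: real and r :: "nat \<Rightarrow> real \<Rightarrow> nat" and N :: "real \<Rightarrow> nat" and \<phi> :: "real \<Rightarrow> real"
  assume K: "K > 0 \<and> (\<forall>n. \<theta> n < K)"
    and r: "rate_of_divergence r \<alpha>"
    and \<phi>: "\<forall>\<epsilon>>0. \<phi> \<epsilon> > 0"
    and step: "\<forall>\<epsilon>>0. \<forall>n\<ge>N \<epsilon>. \<epsilon> < \<theta> (n + 1) \<longrightarrow> \<theta> (n + 1) \<le> \<theta> n - \<alpha> n * \<phi> \<epsilon>"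
  show "rate_of_convergence (Psi K r N \<phi>) \<theta>"
    unfolding rate_of_convergence_def Psi_def
  proof (intro allI impI)
    fix \<epsilon> :: real and n
    assume "\<epsilon> > 0" and n: "n \<ge> r (N \<epsilon>) (K / \<phi> \<epsilon>) + 1"
    then have sum: "(\<Sum>i=N \<epsilon>..r (N \<epsilon>) (K / \<phi> \<epsilon>). \<alpha> i) \<ge> K / \<phi> \<epsilon>"
      using r K \<phi> unfolding rate_of_divergence_def by simp
    \<comment> \<open>Here \<open>m\<close> is
      \<open>r (N \<epsilon>) (K / \<phi> \<epsilon>)\<close>; the \<open>+ 1\<close> in
      \<open>Psi\<close> is the shift to \<open>Suc m\<close>, the first index known to lie at or
      below \<open>\<epsilon>\<close>.\<close>
    show "\<theta> n \<le> \<epsilon>"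
      by (rule descent_below[OF assms(1,2) _ _ _ _ sum])
        (use K \<phi> step \<open>\<epsilon> > 0\<close> n in auto)
  qed
qed

end
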